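(* Let $1<p,q<\infty$, $t_0>0$ and let $n\ge0$ be an integer. Let $u(t)$ and $\tilde u(t)$ be two eigenfunctions of $$\big(\operatorname{sgn}(u'')|u''|^{p-1}\big)''=\lambda\, \operatorname{sgn}(u)|u|^{q-1}\quad (0\le t\le t_0),\qquad u(0)=u(t_0)=u''(0)=u''(t_0)=0,$$ associated with eigenvalues $\lambda>0$ and $\tilde\lambda>0$ respectively, such that they both have $n$ zeros in $(0,t_0)$. Then, for some $a>0$, $\tilde u(t)=\pm a\,u(t)$ and $\tilde\lambda=\lambda a^{p-q}$.
   Context: An eigenfunction with eigenvalue $\lambda>0$ is a real function $u\not\equiv0$ on $[0,t_0]$ satisfying the equation and boundary conditions, in the sense that $u$, $u'$, $\operatorname{sgn}(u'')|u''|^{p-1}$ and $(\operatorname{sgn}(u'')|u''|^{p-1})'$ are of class $C^1$ on $[0,t_0]$ and the equation holds there. *)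

theory Defs
  imports "HOL-Analysis.Analysis"
begin

definition signed_powr :: "real \<Rightarrow> real \<Rightarrow> real" where
  "signed_powr r x = sgn x * \<bar>x\<bar> powr r"

text \<open>Derivatives are taken within the set, hence one-sided at the end points of an interval.\<close>

definition deriv_on :: "real set \<Rightarrow> (real \<Rightarrow> real) \<Rightarrow> real \<Rightarrow> real" where
  "deriv_on S f t = vector_derivative f (at t within S)"

definition C1_on :: "real set \<Rightarrow> (real \<Rightarrow> real) \<Rightarrow> bool" where
  "C1_on S f \<longleftrightarrow> f differentiable_on S \<and> continuous_on S (deriv_on S f)"

text \<open>A function on \<open>[0, t0]\<close> is represented by a total function of which only the values on
  \<open>{0..t0}\<close> matter.\<close>

definition eigenfunction :: "real \<Rightarrow> real \<Rightarrow> real \<Rightarrow> real \<Rightarrow> (real \<Rightarrow> real) \<Rightarrow> bool" where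
  "eigenfunction p q t0 lam u \<longleftrightarrow>
    (let I = {0..t0};
         u1 = deriv_on I u;
         u2 = deriv_on I u1;
         w = (\<lambda>t. signed_powr (p - 1) (u2 t));
         w1 = deriv_on I w;
         w2 = deriv_on I w1
     in lam > 0 \<and> (\<exists>t\<in>I. u t \<noteq> 0)
        \<and> C1_on I u \<and> C1_on I u1 \<and> C1_on I w \<and> C1_on I w1
        \<and> (\<forall>t\<in>I. w2 t = lam * signed_powr (q - 1) (u t))
        \<and> u 0 = 0 \<and> u t0 = 0 \<and> u2 0 = 0 \<and> u2 t0 = 0)"

text \<open>Finiteness is required separately, since \<open>card\<close> is \<open>0\<close> on infinite sets.\<close>

definition has_n_zeros :: "nat \<Rightarrow> real set \<Rightarrow> (real \<Rightarrow> real) \<Rightarrow> bool" where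
  "has_n_zeros n S u \<longleftrightarrow> finite {t \<in> S. u t = 0} \<and> card {t \<in> S. u t = 0} = n"

end

theory Submission
  imports Defs
begin

text \<open>With \<open>w = signed_powr (p - 1) u''\<close>, \<open>r = 1 / (p - 1)\<close> and \<open>s = q - 1\<close> the equation
  becomes the system \<open>u'' = signed_powr r w\<close>, \<open>w'' = lam * signed_powr s u\<close>, which is cooperative:
  if the difference of two solutions has nonnegative data in all four components, it keeps growing.
  Comparison with \<open>0\<close>, forwards and backwards in time, shows that an eigenfunction never has
  \<open>u = u' = 0\<close> or \<open>w = w' = 0\<close>. After scaling amplitude and time, the two eigenfunctions solve the
  same system with the same \<open>u'(0)\<close>, on intervals of possibly different lengths. Repeated odd reflection
  extends both to bounded solutions on arbitrarily long intervals; if \<open>w'(0)\<close> differed, the difference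
  of the \<open>w\<close>-components would grow linearly. So all data agree. Since all zeros of \<open>u\<close> and \<open>w\<close> are simple,
  the initial value problem has a unique solution although \<open>signed_powr\<close> is not Lipschitz at \<open>0\<close>, and
  the number of zeros forces the intervals to coincide.\<close>

section \<open>Signed powers\<close>

lemma signed_powr_0 [simp]: "signed_powr r 0 = 0"
  by (simp add: signed_powr_def)

lemma signed_powr_minus [simp]: "signed_powr r (- x) = - signed_powr r x"
  by (simp add: signed_powr_def sgn_minus)

lemma signed_powr_pos: "x > 0 \<Longrightarrow> signed_powr r x = x powr r"
  by (simp add: signed_powr_def)

lemma signed_powr_mult: "signed_powr r (c * x) = signed_powr r c * signed_powr r x"
  by (simp add: signed_powr_def sgn_mult abs_mult powr_mult)

lemma signed_powr_less_iff:
  assumes "r > 0"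
  shows "signed_powr r x < signed_powr r y \<longleftrightarrow> x < y"
proof -
  have less: "signed_powr r x < signed_powr r y" if "x < y" for x y
  proof (cases "x \<ge> 0")
    case True
    then show ?thesis
      using that assms powr_less_mono2[of r x y]
      by (cases "x = 0") (auto simp: signed_powr_def)
  next
    case x: False
    show ?thesis
    proof (cases "y < 0")
      case True
      then show ?thesis
        using x that assms powr_less_mono2[of r "-y" "-x"] by (simp add: signed_powr_def)
    next
      case False
      have "signed_powr r x < 0"
        using x by (simp add: signed_powr_def)
      also have "0 \<le> signed_powr r y"
        using False by (simp add: signed_powr_def sgn_if)
      finally show ?thesis .
    qed
  qed
  show ?thesis
    using less[of x y] less[of y x] by (cases x y rule: linorder_cases) auto
qed

lemma signed_powr_inverse:
  assumes "r > 0"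
  shows "signed_powr (1 / r) (signed_powr r x) = x"
  using assms by (cases x "0::real" rule: linorder_cases)
    (auto simp: signed_powr_def abs_mult powr_powr sgn_mult)

lemma signed_powr_pos_iff:
  assumes "s > 0"
  shows "signed_powr s x > 0 \<longleftrightarrow> x > 0"
  using signed_powr_less_iff[OF assms, of 0 x] by simp

text \<open>For \<open>s < 1\<close> the map \<open>x \<mapsto> x powr s\<close> is not Lipschitz at \<open>0\<close>; the loss is
  compensated by the distance from \<open>0\<close> of the arguments.\<close>

lemma powr_diff_le:
  fixes x y :: real
  assumes s: "s > 0" and c: "c > 0" and h: "0 < h" "h \<le> 1"
    and x: "c * h \<le> x" "x \<le> C" and y: "c * h \<le> y" "y \<le> C"
    and xy: "\<bar>y - x\<bar> \<le> h * M"
  shows "\<bar>y powr s - x powr s\<bar> \<le> s * (c powr (s - 1) + C powr (s - 1)) * M"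
proof -
  have ch: "0 < c * h" using c h by simp
  \<comment> \<open>The derivative of \<open>powr s\<close> may blow up like
    \<open>z powr (s - 1)\<close> near 0, but the factor \<open>h\<close> absorbs this for
    \<open>s < 1\<close>, because
    \<open>h * (c * h) powr (s - 1) = c powr (s - 1) * h powr s\<close>. For
    \<open>s \<ge> 1\<close> the derivative is largest at \<open>C\<close>. The two summands cover
    the two cases.\<close>
  have bd: "h * z powr (s - 1) \<le> c powr (s - 1) + C powr (s - 1)" if "c * h \<le> z" "z \<le> C" for z
  proof (cases "s \<ge> 1")
    case True
    have "h * z powr (s - 1) \<le> 1 * z powr (s - 1)"
      using h by (intro mult_right_mono) auto
    also have "\<dots> \<le> C powr (s - 1)"
      using True that ch by (auto intro!: powr_mono2)
    finally show ?thesis using powr_ge_zero[of c "s - 1"] by linarith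
  next
    case False
    have "h * z powr (s - 1) \<le> h * (c * h) powr (s - 1)"
      using False that ch h by (intro mult_left_mono powr_mono2') auto
    also have "\<dots> = c powr (s - 1) * (h powr 1 * h powr (s - 1))"
      using h c by (simp add: powr_mult)
    also have "h powr 1 * h powr (s - 1) = h powr (1 + (s - 1))"
      by (rule powr_add[symmetric])
    also have "1 + (s - 1) = s" by simp
    also have "c powr (s - 1) * h powr s \<le> c powr (s - 1) * 1"
      using h s powr_mono2[of s h 1] by (intro mult_left_mono) auto
    finally show ?thesis using powr_ge_zero[of C "s - 1"] by linarith
  qed
  have der: "((\<lambda>x. x powr s) has_field_derivative s * z powr (s - 1)) (at z within {c*h..C})"
    if "z \<in> {c*h..C}" for z
    using that ch by (intro has_real_derivative_powr[THEN has_field_derivative_at_within]) auto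
  have "norm (y powr s - x powr s)
        \<le> (s * ((c powr (s - 1) + C powr (s - 1)) / h)) * norm (y - x)"
  proof (rule field_differentiable_bound[OF _ der])
    fix z assume "z \<in> {c*h..C}"
    then have "z powr (s - 1) \<le> (c powr (s - 1) + C powr (s - 1)) / h"
      using bd[of z] h by (simp add: pos_le_divide_eq mult.commute)
    then have "s * z powr (s - 1) \<le> s * ((c powr (s - 1) + C powr (s - 1)) / h)"
      using s by (intro mult_left_mono) auto
    then show "norm (s * z powr (s - 1)) \<le> s * ((c powr (s - 1) + C powr (s - 1)) / h)"
      using s by (simp only: real_norm_def abs_mult abs_of_pos abs_of_nonneg[OF powr_ge_zero])
  qed (use x y in auto)
  also have "\<dots> \<le> (s * ((c powr (s - 1) + C powr (s - 1)) / h)) * (h * M)"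
    using xy s h by (intro mult_left_mono) auto
  also have "\<dots> = s * (c powr (s - 1) + C powr (s - 1)) * M"
    using h by simp
  finally show ?thesis by simp
qed

section \<open>Convexity and comparison\<close>

lemma deriv_pos_less:
  fixes f :: "real \<Rightarrow> real"
  assumes "a < t" "t \<le> b"
    and der: "\<And>t. t \<in> {a..b} \<Longrightarrow> (f has_real_derivative f' t) (at t within {a..b})"
    and pos: "\<And>x. a < x \<Longrightarrow> x < t \<Longrightarrow> f' x > 0"
  shows "f a < f t"
proof (rule DERIV_pos_imp_increasing_open[OF \<open>a < t\<close>])
  fix x assume x: "a < x" "x < t"
  then have "(f has_real_derivative f' x) (at x)"
    using der[of x] assms(2) by (simp add: at_within_Icc_at)
  then show "\<exists>y. DERIV f x :> y \<and> y > 0"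
    using pos x by blast
next
  have "continuous_on {a..b} f"
    using der by (meson DERIV_continuous_on)
  then show "continuous_on {a..t} f"
    by (rule continuous_on_subset) (use assms(2) in auto)
qed

text \<open>\<open>f1\<close> increases strictly, so \<open>f\<close> minus its tangent at
  \<open>a\<close> has a positive derivative. Positivity of \<open>f2\<close> is assumed only on the
  open interval, while the conclusion includes \<open>s\<close>: this is what excludes a first
  return to 0 at \<open>s\<close>.\<close>

lemma second_deriv_pos_above_tangent:
  fixes f :: "real \<Rightarrow> real"
  assumes "s \<le> b"
    and der: "\<And>t. t \<in> {a..b} \<Longrightarrow> (f has_real_derivative f1 t) (at t within {a..b})"
    and der1: "\<And>t. t \<in> {a..b} \<Longrightarrow> (f1 has_real_derivative f2 t) (at t within {a..b})"
    and pos: "\<And>x. a < x \<Longrightarrow> x < s \<Longrightarrow> f2 x > 0"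
    and t: "a < t" "t \<le> s"
  shows "f t > f a + f1 a * (t - a)"
proof -
  have *: "f1 a < f1 x" if "a < x" "x < t" for x
    using that t assms(1) by (intro deriv_pos_less[OF _ _ der1 pos]) auto
  have "f a - f1 a * a < f t - f1 a * t"
  proof (rule deriv_pos_less[where f = "\<lambda>t. f t - f1 a * t" and f' = "\<lambda>t. f1 t - f1 a"])
    show "((\<lambda>t. f t - f1 a * t) has_real_derivative f1 t - f1 a) (at t within {a..b})"
      if "t \<in> {a..b}" for t
      using der[OF that] by (auto intro!: derivative_eq_intros)
  qed (use t assms(1) * in auto)
  then show ?thesis by (simp add: algebra_simps)
qed

text \<open>Supplies the short initial interval of positivity from which the comparison starts, by
  continuity or by a positive one-sided slope.\<close>

lemma pos_right_of:
  fixes f :: "real \<Rightarrow> real"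
  assumes der: "\<And>t. t \<in> {a..b} \<Longrightarrow> (f has_real_derivative f' t) (at t within {a..b})"
    and "a < b" and pos: "f a > 0 \<or> f a = 0 \<and> f' a > 0"
  obtains e where "e > 0" "\<And>t. a < t \<Longrightarrow> t < a + e \<Longrightarrow> t \<le> b \<Longrightarrow> f t > 0"
proof (cases "f a > 0")
  case True
  have "continuous_on {a..b} f"
    using der by (meson DERIV_continuous_on)
  then obtain d where d: "d > 0" "\<forall>t\<in>{a..b}. dist t a < d \<longrightarrow> dist (f t) (f a) < f a"
    using True \<open>a < b\<close> unfolding continuous_on_iff by (metis atLeastAtMost_iff less_eq_real_def)
  have "f t > 0" if "a < t" "t < a + d" "t \<le> b" for t
    using d(2)[rule_format, of t] that by (auto simp: dist_real_def)
  then show ?thesis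
    using that[of d] d(1) by blast
next
  case False
  then have "f' a > 0" "f a = 0" using pos by auto
  moreover have "(f has_real_derivative f' a) (at a within {a..b})"
    using der \<open>a < b\<close> by auto
  ultimately obtain d where d: "d > 0" "\<forall>h>0. a + h \<in> {a..b} \<longrightarrow> h < d \<longrightarrow> 0 < f (a + h)"
    using has_real_derivative_pos_inc_right by metis
  show ?thesis
  proof (rule that[of d])
    fix t assume "a < t" "t < a + d" "t \<le> b"
    then show "f t > 0" using d(2)[rule_format, of "t - a"] by auto
  qed (use d in auto)
qed

text \<open>The comparison principle of cooperative systems: while \<open>D\<close> is positive, \<open>E\<close> is
  convex, hence positive, hence \<open>D\<close> is convex and cannot return to \<open>0\<close>.\<close>

lemma cooperative_above_tangents:
  fixes D E :: "real \<Rightarrow> real"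
  assumes "a < b"
    and D: "\<And>t. t \<in> {a..b} \<Longrightarrow> (D has_real_derivative D1 t) (at t within {a..b})"
    and D1: "\<And>t. t \<in> {a..b} \<Longrightarrow> (D1 has_real_derivative D2 t) (at t within {a..b})"
    and E: "\<And>t. t \<in> {a..b} \<Longrightarrow> (E has_real_derivative E1 t) (at t within {a..b})"
    and E1: "\<And>t. t \<in> {a..b} \<Longrightarrow> (E1 has_real_derivative E2 t) (at t within {a..b})"
    and coop: "\<And>t. t \<in> {a..b} \<Longrightarrow> E t > 0 \<Longrightarrow> D2 t > 0"
              "\<And>t. t \<in> {a..b} \<Longrightarrow> D t > 0 \<Longrightarrow> E2 t > 0"
    and init: "D a \<ge> 0" "D1 a \<ge> 0" "E a \<ge> 0" "E1 a \<ge> 0"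
    and start: "e > 0" "\<And>t. a < t \<Longrightarrow> t < a + e \<Longrightarrow> t \<le> b \<Longrightarrow> D t > 0"
    and t: "a < t" "t \<le> b"
  shows "D t > D a + D1 a * (t - a)" "E t > E a + E1 a * (t - a)"
proof -
  have step: "D t > D a + D1 a * (t - a) \<and> E t > E a + E1 a * (t - a)"
    if s: "s \<le> b" "\<And>x. a < x \<Longrightarrow> x < s \<Longrightarrow> D x > 0" and t: "a < t" "t \<le> s" for s t
  proof -
    have Et: "E x > E a + E1 a * (x - a)" if "a < x" "x \<le> s" for x
      using s that by (intro second_deriv_pos_above_tangent[OF _ E E1, of s] coop) auto
    have Ep: "E x > 0" if "a < x" "x \<le> s" for x
      using Et[OF that] init that by (smt (verit) mult_nonneg_nonneg)
    have "D t > D a + D1 a * (t - a)"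
      using s t Ep by (intro second_deriv_pos_above_tangent[OF _ D D1, of s] coop) auto
    then show ?thesis using Et t by auto
  qed
  \<comment> \<open>Otherwise the compact set of points in \<open>{a + e..b}\<close> with
    \<open>D \<le> 0\<close> has a least element \<open>s\<close>. Up to \<open>s\<close> the
    function \<open>D\<close> is positive, so \<open>step\<close> puts \<open>D s\<close> above a
    nonnegative tangent value.\<close>
  have pos: "D x > 0" if x: "a < x" "x \<le> b" for x
  proof (rule ccontr)
    assume neg: "\<not> D x > 0"
    have "continuous_on {a..b} D"
      using D by (meson DERIV_continuous_on)
    then have "continuous_on {a + e..b} D"
      by (rule continuous_on_subset) (use start in auto)
    then have "compact ({a + e..b} \<inter> D -` {..0})"
      by (intro compact_eq_bounded_closed[THEN iffD2] conjI continuous_closed_preimage)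
        (auto intro: bounded_subset[of "{a + e..b}"])
    moreover have "x \<in> {a + e..b} \<inter> D -` {..0}"
      using neg start(2)[of x] x by (cases "x < a + e") auto
    ultimately obtain s where s: "s \<in> {a + e..b} \<inter> D -` {..0}"
        "\<forall>t\<in>{a + e..b} \<inter> D -` {..0}. s \<le> t"
      using compact_attains_inf[of "{a + e..b} \<inter> D -` {..0}"] by blast
    have "D s > D a + D1 a * (s - a)"
    proof (rule step[THEN conjunct1])
      show "D t > 0" if "a < t" "t < s" for t
        using s(1) s(2)[rule_format, of t] that start(2)[of t] by (cases "t < a + e"; fastforce)
    qed (use s start(1) in auto)
    moreover have "D1 a * (s - a) \<ge> 0"
      using s init start(1) by auto
    ultimately show False using s init by auto
  qed
  show "D t > D a + D1 a * (t - a)" "E t > E a + E1 a * (t - a)"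
    using step[of b t] pos t by auto
qed

section \<open>The system and its symmetries\<close>

text \<open>A Lane-Emden system written in first order form: comparison, gluing and uniqueness all
  refer to the full state of four components. Derivatives within the interval keep the notion stable
  under restriction and gluing at end points.\<close>

definition lane_emden :: "real \<Rightarrow> real \<Rightarrow> real \<Rightarrow> real \<Rightarrow> real \<Rightarrow>
    (real \<Rightarrow> real) \<Rightarrow> (real \<Rightarrow> real) \<Rightarrow> (real \<Rightarrow> real) \<Rightarrow> (real \<Rightarrow> real) \<Rightarrow> bool" where
  "lane_emden r s lam a b u u1 w w1 \<longleftrightarrow> (\<forall>t\<in>{a..b}.
     (u has_real_derivative u1 t) (at t within {a..b}) \<and>
     (u1 has_real_derivative signed_powr r (w t)) (at t within {a..b}) \<and>
     (w has_real_derivative w1 t) (at t within {a..b}) \<and>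
     (w1 has_real_derivative lam * signed_powr s (u t)) (at t within {a..b}))"

lemma lane_emdenD:
  assumes "lane_emden r s lam a b u u1 w w1" "t \<in> {a..b}"
  shows "(u has_real_derivative u1 t) (at t within {a..b})"
    "(u1 has_real_derivative signed_powr r (w t)) (at t within {a..b})"
    "(w has_real_derivative w1 t) (at t within {a..b})"
    "(w1 has_real_derivative lam * signed_powr s (u t)) (at t within {a..b})"
  using assms by (auto simp: lane_emden_def)

lemma lane_emden_continuous_on:
  assumes "lane_emden r s lam a b u u1 w w1"
  shows "continuous_on {a..b} u" "continuous_on {a..b} u1"
    "continuous_on {a..b} w" "continuous_on {a..b} w1"
  by (rule DERIV_continuous_on, erule lane_emdenD[OF assms])+

lemma lane_emden_subinterval:
  assumes "lane_emden r s lam a b u u1 w w1" "a \<le> a'" "b' \<le> b"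
  shows "lane_emden r s lam a' b' u u1 w w1"
proof -
  have "{a'..b'} \<subseteq> {a..b}" using assms by auto
  then show ?thesis
    using assms(1) unfolding lane_emden_def by (blast intro: DERIV_subset)
qed

text \<open>Two derivatives of a function of \<open>c * t + d\<close> produce
  \<open>c\<^sup>2\<close>, so the conditions on \<open>A\<close> and \<open>C\<close> say that the
  scalings pass through the nonlinearities. Sign change, time reversal, odd reflection and the
  normalization of eigenfunctions are all instances.\<close>

lemma lane_emden_affine:
  assumes sol: "lane_emden r s lam a b u u1 w w1"
    and sub: "\<And>t. t \<in> {a'..b'} \<Longrightarrow> c * t + d \<in> {a..b}"
    and r: "\<And>z. A * c\<^sup>2 * signed_powr r z = signed_powr r (C * z)"
    and s: "\<And>z. C * c\<^sup>2 * lam * signed_powr s z = lam' * signed_powr s (A * z)"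
  shows "lane_emden r s lam' a' b' (\<lambda>t. A * u (c * t + d)) (\<lambda>t. A * c * u1 (c * t + d))
           (\<lambda>t. C * w (c * t + d)) (\<lambda>t. C * c * w1 (c * t + d))"
proof -
  have chain: "((\<lambda>t. K * f (c * t + d)) has_real_derivative K * c * f') (at t within {a'..b'})"
    if "t \<in> {a'..b'}" "(f has_real_derivative f') (at (c * t + d) within {a..b})"
    for K f f' t
  proof -
    have "(f has_real_derivative f') (at (c * t + d) within (\<lambda>t. c * t + d) ` {a'..b'})"
      using that(2) by (rule DERIV_subset) (use sub in auto)
    moreover have "((\<lambda>t. c * t + d) has_real_derivative c) (at t within {a'..b'})"
      by (auto intro!: derivative_eq_intros)
    ultimately have "(f \<circ> (\<lambda>t. c * t + d) has_real_derivative f' * c) (at t within {a'..b'})"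
      by (rule DERIV_image_chain)
    then show ?thesis
      using DERIV_cmult[of "f \<circ> (\<lambda>t. c * t + d)" "f' * c" t "{a'..b'}" K]
      by (simp add: o_def mult_ac)
  qed
  have eqs: "A * c * c * signed_powr r z = signed_powr r (C * z)"
    "C * c * c * (lam * signed_powr s z) = lam' * signed_powr s (A * z)" for z
    using r[of z] s[of z] by (simp_all add: power2_eq_square mult_ac)
  show ?thesis
    unfolding lane_emden_def
  proof (intro ballI conjI)
    fix t assume t: "t \<in> {a'..b'}"
    note D = lane_emdenD[OF sol sub[OF t]]
    show "((\<lambda>t. A * u (c * t + d)) has_real_derivative A * c * u1 (c * t + d)) (at t within {a'..b'})"
      by (rule chain[OF t D(1)])
    show "((\<lambda>t. A * c * u1 (c * t + d)) has_real_derivative signed_powr r (C * w (c * t + d)))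
        (at t within {a'..b'})"
      using chain[OF t D(2), of "A * c"] by (simp only: eqs)
    show "((\<lambda>t. C * w (c * t + d)) has_real_derivative C * c * w1 (c * t + d)) (at t within {a'..b'})"
      by (rule chain[OF t D(3)])
    show "((\<lambda>t. C * c * w1 (c * t + d)) has_real_derivative lam' * signed_powr s (A * u (c * t + d)))
        (at t within {a'..b'})"
      using chain[OF t D(4), of "C * c"] by (simp only: eqs)
  qed
qed

lemma lane_emden_uminus:
  assumes "lane_emden r s lam a b u u1 w w1"
  shows "lane_emden r s lam a b (\<lambda>t. - u t) (\<lambda>t. - u1 t) (\<lambda>t. - w t) (\<lambda>t. - w1 t)"
  using lane_emden_affine[OF assms, where a' = a and b' = b and A = "-1" and C = "-1" and c = 1 and d = 0]
  by simp

lemma lane_emden_reverse: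
  assumes "lane_emden r s lam a b u u1 w w1"
  shows "lane_emden r s lam (-b) (-a) (\<lambda>t. u (-t)) (\<lambda>t. - u1 (-t)) (\<lambda>t. w (-t)) (\<lambda>t. - w1 (-t))"
  using lane_emden_affine[OF assms, where a' = "-b" and b' = "-a" and A = 1 and C = 1 and c = "-1" and d = 0]
  by simp

lemma has_real_derivative_glue:
  fixes f g :: "real \<Rightarrow> real"
  assumes "a \<le> b" "b \<le> c" and t: "t \<in> {a..c}"
    and f: "t \<in> {a..b} \<Longrightarrow> (f has_real_derivative f' t) (at t within {a..b})"
    and g: "t \<in> {b..c} \<Longrightarrow> (g has_real_derivative g' t) (at t within {b..c})"
    and eq: "f b = g b" "f' b = g' b"
  shows "((\<lambda>t. if t \<le> b then f t else g t) has_real_derivative (if t \<le> b then f' t else g' t))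
           (at t within {a..c})"
proof -
  have int: "{a..b} \<inter> {b..c} = {b}" "insert b {a..b} = {a..b}" "insert b {b..c} = {b..c}"
    using assms by auto
  have "((\<lambda>t. if t \<in> {a..b} then f t else g t) has_vector_derivative
           (if t \<in> {a..b} then f' t else g' t)) (at t within {a..c})"
    by (rule has_vector_derivative_If_within_closures[where T = "{b..c}"])
      (use assms in \<open>auto simp: int has_real_derivative_iff_has_vector_derivative\<close>)
  then have "((\<lambda>t. if t \<in> {a..b} then f t else g t) has_real_derivative
           (if t \<le> b then f' t else g' t)) (at t within {a..c})"
    using t by (simp add: has_real_derivative_iff_has_vector_derivative split: if_splits)
  then show ?thesis
    by (rule has_field_derivative_transform_within[where d = 1]) (use t in auto)
qed

lemma lane_emden_glue:
  assumes "a \<le> b" "b \<le> c"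
    and "lane_emden r s lam a b u u1 w w1" "lane_emden r s lam b c v v1 z z1"
    and "u b = v b" "u1 b = v1 b" "w b = z b" "w1 b = z1 b"
  shows "lane_emden r s lam a c (\<lambda>t. if t \<le> b then u t else v t) (\<lambda>t. if t \<le> b then u1 t else v1 t)
           (\<lambda>t. if t \<le> b then w t else z t) (\<lambda>t. if t \<le> b then w1 t else z1 t)"
proof -
  note D = lane_emdenD[OF assms(3)] lane_emdenD[OF assms(4)]
  \<comment> \<open>The derivatives of \<open>u1\<close> and \<open>w1\<close> are functions of the
    state, so agreement of the states at \<open>b\<close> already makes all one-sided derivatives
    agree.\<close>
  have "signed_powr r (w b) = signed_powr r (z b)" "lam * signed_powr s (u b) = lam * signed_powr s (v b)"
    using assms by auto
  then show ?thesis
    unfolding lane_emden_def if_distrib[of "signed_powr _"] if_distrib[of "(*) _"]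
    by (intro ballI conjI has_real_derivative_glue D assms)
qed

section \<open>Comparison with zero and simplicity of zeros\<close>

text \<open>The comparison principle applied to the solution itself, that is, to its difference from
  the zero solution. The last alternative in \<open>pos\<close> serves solutions that leave the zero
  state although all their data at \<open>a\<close> vanish.\<close>

lemma lane_emden_pos:
  assumes sol: "lane_emden r s lam a b u u1 w w1" and "r > 0" "s > 0" "lam > 0" "a < b"
    and init: "u a \<ge> 0" "u1 a \<ge> 0" "w a \<ge> 0" "w1 a \<ge> 0"
    and pos: "u a > 0 \<or> u1 a > 0 \<or> w a > 0 \<or> w1 a > 0 \<or> (\<exists>e>0. \<forall>t. a < t \<and> t < a + e \<and> t \<le> b \<longrightarrow> u t > 0)"
  shows "u b > 0"
proof -
  note D = lane_emdenD[OF sol]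
  have coop: "signed_powr r (w t) > 0" if "w t > 0" for t
    using that \<open>r > 0\<close> by (simp add: signed_powr_pos_iff)
  have coop': "lam * signed_powr s (u t) > 0" if "u t > 0" for t
    using that \<open>s > 0\<close> \<open>lam > 0\<close> by (simp add: signed_powr_pos_iff)
  \<comment> \<open>Whichever of \<open>u\<close> and \<open>w\<close> becomes positive first takes
    the role of \<open>D\<close> in \<open>cooperative_above_tangents\<close>, the other that of
    \<open>E\<close>.\<close>
  consider (w) "w a > 0 \<or> w a = 0 \<and> w1 a > 0" | (u) "u a > 0 \<or> u a = 0 \<and> u1 a > 0"
    | (r) "\<exists>e>0. \<forall>t. a < t \<and> t < a + e \<and> t \<le> b \<longrightarrow> u t > 0"
    using init(1,3) pos unfolding le_less by metis
  then have "u b > u a + u1 a * (b - a)"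
  proof cases
    case w
    obtain e where e: "e > 0" "\<And>t. a < t \<Longrightarrow> t < a + e \<Longrightarrow> t \<le> b \<Longrightarrow> w t > 0"
      using pos_right_of[OF D(3) \<open>a < b\<close> w] by blast
    show ?thesis
      by (rule cooperative_above_tangents(2)[OF \<open>a < b\<close> D(3,4,1,2) coop' coop init(3,4,1,2) e])
        (use \<open>a < b\<close> in auto)
  next
    case u
    obtain e where e: "e > 0" "\<And>t. a < t \<Longrightarrow> t < a + e \<Longrightarrow> t \<le> b \<Longrightarrow> u t > 0"
      using pos_right_of[OF D(1) \<open>a < b\<close> u] by blast
    show ?thesis
      by (rule cooperative_above_tangents(1)[OF \<open>a < b\<close> D coop coop' init e])
        (use \<open>a < b\<close> in auto)
  next
    case r
    then obtain e where e: "e > 0" "\<And>t. a < t \<Longrightarrow> t < a + e \<Longrightarrow> t \<le> b \<Longrightarrow> u t > 0"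
      by blast
    show ?thesis
      by (rule cooperative_above_tangents(1)[OF \<open>a < b\<close> D coop coop' init e])
        (use \<open>a < b\<close> in auto)
  qed
  moreover have "u1 a * (b - a) \<ge> 0" using init \<open>a < b\<close> by simp
  ultimately show ?thesis using init by simp
qed

text \<open>Finiteness of the zero set excludes the non-unique branching off the zero solution,
  which occurs for \<open>r * s < 1\<close>.\<close>

lemma lane_emden_no_zero_after_ordered:
  assumes sol: "lane_emden r s lam a b u u1 w w1" and pars: "r > 0" "s > 0" "lam > 0" and "a < b"
    and fin: "finite {t \<in> {a..b}. u t = 0}" and b: "u b = 0"
    and ord: "(u a \<ge> 0 \<and> u1 a \<ge> 0 \<and> w a \<ge> 0 \<and> w1 a \<ge> 0) \<or>
              (u a \<le> 0 \<and> u1 a \<le> 0 \<and> w a \<le> 0 \<and> w1 a \<le> 0)"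
  shows False
proof (cases "u a = 0 \<and> u1 a = 0 \<and> w a = 0 \<and> w1 a = 0")
  case False
  show False
    using ord
  proof
    assume "u a \<ge> 0 \<and> u1 a \<ge> 0 \<and> w a \<ge> 0 \<and> w1 a \<ge> 0"
    then show False
      using lane_emden_pos[OF sol pars \<open>a < b\<close>] False b by auto
  next
    assume "u a \<le> 0 \<and> u1 a \<le> 0 \<and> w a \<le> 0 \<and> w1 a \<le> 0"
    then show False
      using lane_emden_pos[OF lane_emden_uminus[OF sol] pars \<open>a < b\<close>] False b by auto
  qed
next
  case True
  \<comment> \<open>With zero data, finiteness isolates \<open>a\<close> among the zeros of
    \<open>u\<close>. So \<open>u\<close> keeps one sign just to the right of \<open>a\<close>, and
    the last alternative of \<open>lane_emden_pos\<close> applies to \<open>u\<close> or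
    \<open>- u\<close>.\<close>
  obtain e0 where e0: "e0 > 0" "\<And>x. x \<in> {a..b} \<Longrightarrow> u x = 0 \<Longrightarrow> x \<noteq> a \<Longrightarrow> e0 \<le> dist a x"
    using finite_set_avoid[OF fin, of a] by auto
  define e where "e = min e0 (b - a)"
  have nz: "u x \<noteq> 0" if "a < x" "x < a + e" for x
  proof -
    have "x \<in> {a..b}" "x - a < e0" using that by (auto simp: e_def)
    then show ?thesis using e0(2)[of x] that by (auto simp: dist_real_def)
  qed
  have e_pos: "e > 0" and e_le: "a + e \<le> b"
    using e0 \<open>a < b\<close> by (auto simp: e_def)
  have "connected (u ` {a<..<a + e})"
    using e_le by (intro connected_continuous_image continuous_on_subset[OF lane_emden_continuous_on(1)[OF sol]]) auto
  moreover have "0 \<notin> u ` {a<..<a + e}"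
    using nz by auto
  ultimately have "(\<forall>y\<in>u ` {a<..<a + e}. y > 0) \<or> (\<forall>y\<in>u ` {a<..<a + e}. y < 0)"
    by (meson connectedD_interval not_less)
  then have "(\<forall>x\<in>{a<..<a + e}. u x > 0) \<or> (\<forall>x\<in>{a<..<a + e}. u x < 0)"
    by blast
  then show False
  proof
    assume "\<forall>x\<in>{a<..<a + e}. u x > 0"
    then have "\<exists>e>0. \<forall>t. a < t \<and> t < a + e \<and> t \<le> b \<longrightarrow> u t > 0"
      using e_pos by (intro exI[of _ e]) auto
    then show False
      using lane_emden_pos[OF sol pars \<open>a < b\<close>] True b by auto
  next
    assume "\<forall>x\<in>{a<..<a + e}. u x < 0"
    then have "\<exists>e>0. \<forall>t. a < t \<and> t < a + e \<and> t \<le> b \<longrightarrow> - u t > 0"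
      using e_pos by (intro exI[of _ e]) auto
    then show False
      using lane_emden_pos[OF lane_emden_uminus[OF sol] pars \<open>a < b\<close>] True b by auto
  qed
qed

text \<open>Time reversal flips the signs of \<open>u1\<close> and \<open>w1\<close> only, which
  explains the mixed signs in \<open>ord\<close>.\<close>

lemma lane_emden_no_zero_before_ordered:
  assumes sol: "lane_emden r s lam a b u u1 w w1" and pars: "r > 0" "s > 0" "lam > 0" and "a < b"
    and fin: "finite {t \<in> {a..b}. u t = 0}" and a: "u a = 0"
    and ord: "(u b \<ge> 0 \<and> u1 b \<le> 0 \<and> w b \<ge> 0 \<and> w1 b \<le> 0) \<or>
              (u b \<le> 0 \<and> u1 b \<ge> 0 \<and> w b \<le> 0 \<and> w1 b \<ge> 0)"
  shows False
proof (rule lane_emden_no_zero_after_ordered[OF lane_emden_reverse[OF sol] pars])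
  have "{t \<in> {-b..-a}. u (-t) = 0} \<subseteq> uminus ` {t \<in> {a..b}. u t = 0}"
  proof
    fix t assume "t \<in> {t \<in> {-b..-a}. u (-t) = 0}"
    then show "t \<in> uminus ` {t \<in> {a..b}. u t = 0}"
      by (intro image_eqI[of _ _ "- t"]) auto
  qed
  then show "finite {t \<in> {-b..-a}. u (-t) = 0}"
    using fin by (meson finite_imageI finite_subset)
qed (use \<open>a < b\<close> a ord in auto)

text \<open>If \<open>u\<close> and \<open>u1\<close> vanish at \<open>t\<close>, then
  \<open>w\<close> and \<open>w1\<close> have either weakly equal signs, so the state is ordered for
  the future and \<open>u T\<close> cannot vanish, or weakly opposite signs, so it is ordered for
  the past and \<open>u 0\<close> cannot vanish. A double zero of \<open>w\<close> is excluded in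
  the same way.\<close>

lemma lane_emden_simple_zeros:
  assumes sol: "lane_emden r s lam 0 T u u1 w w1" and pars: "r > 0" "s > 0" "lam > 0"
    and fin: "finite {t \<in> {0..T}. u t = 0}"
    and bc: "u 0 = 0" "u T = 0" "w 0 = 0"
    and t: "0 \<le> t" "t < T"
  shows "u t \<noteq> 0 \<or> u1 t \<noteq> 0" "w t \<noteq> 0 \<or> w1 t \<noteq> 0"
proof -
  have solr: "lane_emden r s lam t T u u1 w w1" and soll: "lane_emden r s lam 0 t u u1 w w1"
    using lane_emden_subinterval[OF sol] t by auto
  have finr: "finite {x \<in> {t..T}. u x = 0}" and finl: "finite {x \<in> {0..t}. u x = 0}"
    using t by (auto intro: finite_subset[OF _ fin])
  note r = lane_emden_no_zero_after_ordered[OF solr pars \<open>t < T\<close> finr bc(2)]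
  note l = lane_emden_no_zero_before_ordered[OF soll pars _ finl bc(1)]
  \<comment> \<open>At \<open>t = 0\<close> there is no past to compare with. There the boundary
    values leave at most one nonzero component in case of a double zero, and such a state is ordered
    for the future.\<close>
  have "t > 0 \<or> (u t = 0 \<and> w t = 0)" using t bc by (cases "t = 0") auto
  with r l show "u t \<noteq> 0 \<or> u1 t \<noteq> 0"
    by (smt (verit))
  from \<open>t > 0 \<or> (u t = 0 \<and> w t = 0)\<close> r l show "w t \<noteq> 0 \<or> w1 t \<noteq> 0"
    by (smt (verit))
qed

section \<open>Uniqueness for the initial value problem\<close>

lemma bounded_on_interval:
  fixes f :: "real \<Rightarrow> real"
  assumes "continuous_on {a..b} f"
  obtains M where "\<And>t. t \<in> {a..b} \<Longrightarrow> \<bar>f t\<bar> \<le> M"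
proof -
  have "bounded (f ` {a..b})"
    using assms by (intro compact_imp_bounded compact_continuous_image) auto
  then obtain M where "\<forall>x\<in>{a..b}. \<bar>f x\<bar> \<le> M"
    by (auto simp: bounded_iff)
  then show ?thesis
    using that by blast
qed

text \<open>Since \<open>x\<close> and \<open>y\<close> share a positive start or a simple zero,
  both lie above a line \<open>c * (t - a)\<close> near \<open>a\<close>, while the mean value
  theorem bounds their difference by \<open>(t - a) * M\<close>. Then \<open>powr_diff_le\<close>
  with \<open>h = t - a\<close> gives a constant independent of \<open>t\<close>.\<close>

lemma signed_powr_diff_le_pos:
  fixes x y :: "real \<Rightarrow> real"
  assumes "s > 0" "a < b"
    and x: "\<And>t. t \<in> {a..b} \<Longrightarrow> (x has_real_derivative x1 t) (at t within {a..b})"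
    and y: "\<And>t. t \<in> {a..b} \<Longrightarrow> (y has_real_derivative y1 t) (at t within {a..b})"
    and eq: "y a = x a" "y1 a = x1 a" and pos: "x a > 0 \<or> x a = 0 \<and> x1 a > 0"
  shows "\<exists>K e. K \<ge> 0 \<and> e > 0 \<and> (\<forall>t M. a \<le> t \<and> t < a + e \<and> t \<le> b \<and>
           (\<forall>z\<in>{a..t}. \<bar>y1 z - x1 z\<bar> \<le> M) \<longrightarrow>
           \<bar>signed_powr s (y t) - signed_powr s (x t)\<bar> \<le> K * M)"
proof -
  \<comment> \<open>If \<open>x a > 0\<close>, a line through 0 of any slope lies below
    \<open>x\<close> for a while; at a simple zero half of the slope of \<open>x\<close> leaves room
    for both functions.\<close>
  define c where "c = (if x a > 0 then 1 else x1 a / 2)"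
  have c: "c > 0" and above: "x a - c * (a - a) > 0 \<or> x a - c * (a - a) = 0 \<and> x1 a - c > 0"
    using pos by (auto simp: c_def)
  have dx: "((\<lambda>t. x t - c * (t - a)) has_real_derivative x1 t - c) (at t within {a..b})"
    if "t \<in> {a..b}" for t
    using x[OF that] by (auto intro!: derivative_eq_intros)
  have dy: "((\<lambda>t. y t - c * (t - a)) has_real_derivative y1 t - c) (at t within {a..b})"
    if "t \<in> {a..b}" for t
    using y[OF that] by (auto intro!: derivative_eq_intros)
  obtain e1 where e1: "e1 > 0" "\<And>t. a < t \<Longrightarrow> t < a + e1 \<Longrightarrow> t \<le> b \<Longrightarrow> x t - c * (t - a) > 0"
    using pos_right_of[OF dx \<open>a < b\<close> above] by blast
  obtain e2 where e2: "e2 > 0" "\<And>t. a < t \<Longrightarrow> t < a + e2 \<Longrightarrow> t \<le> b \<Longrightarrow> y t - c * (t - a) > 0"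
    using pos_right_of[OF dy \<open>a < b\<close>] above eq by metis
  obtain C1 where C1: "\<And>t. t \<in> {a..b} \<Longrightarrow> \<bar>x t\<bar> \<le> C1"
    using bounded_on_interval[OF DERIV_continuous_on[OF x]] by blast
  obtain C2 where C2: "\<And>t. t \<in> {a..b} \<Longrightarrow> \<bar>y t\<bar> \<le> C2"
    using bounded_on_interval[OF DERIV_continuous_on[OF y]] by blast
  define C where "C = max C1 C2"
  define K where "K = s * (c powr (s - 1) + C powr (s - 1))"
  \<comment> \<open>The bound 1 is the condition \<open>h \<le> 1\<close> of
    \<open>powr_diff_le\<close>.\<close>
  define e where "e = min 1 (min e1 e2)"
  have "K \<ge> 0"
    using \<open>s > 0\<close> by (simp add: K_def)
  moreover have "e > 0"
    using e1 e2 by (simp add: e_def)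
  moreover have "\<bar>signed_powr s (y t) - signed_powr s (x t)\<bar> \<le> K * M"
    if t: "a \<le> t" "t < a + e" "t \<le> b" and M: "\<forall>z\<in>{a..t}. \<bar>y1 z - x1 z\<bar> \<le> M" for t M
  proof (cases "t = a")
    case True
    have "M \<ge> 0" using M t by force
    then show ?thesis using True eq \<open>K \<ge> 0\<close> by simp
  next
    case False
    then have at: "a < t" using t by simp
    have "norm ((\<lambda>t. y t - x t) t - (\<lambda>t. y t - x t) a) \<le> M * norm (t - a)"
    proof (rule field_differentiable_bound[where S = "{a..t}"])
      fix z assume z: "z \<in> {a..t}"
      then have z': "z \<in> {a..b}" and sub: "{a..t} \<subseteq> {a..b}" using t by auto
      show "((\<lambda>t. y t - x t) has_real_derivative y1 z - x1 z) (at z within {a..t})"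
        by (rule DERIV_diff[OF y[OF z'] x[OF z'], THEN DERIV_subset, OF sub])
      show "norm (y1 z - x1 z) \<le> M" using M z by simp
    qed (use t in auto)
    then have diff: "\<bar>y t - x t\<bar> \<le> (t - a) * M"
      using eq at by (simp add: mult.commute)
    have low: "c * (t - a) \<le> x t" "c * (t - a) \<le> y t"
      using e1(2)[OF at _ t(3)] e2(2)[OF at _ t(3)] t(2) by (simp_all add: e_def less_imp_le)
    have up: "x t \<le> C" "y t \<le> C"
      using C1[of t] C2[of t] t by (auto simp: C_def)
    have "0 < c * (t - a)" using c at by simp
    then have "x t > 0" "y t > 0" using low by auto
    then have "\<bar>signed_powr s (y t) - signed_powr s (x t)\<bar> = \<bar>y t powr s - x t powr s\<bar>"
      by (simp add: signed_powr_pos)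
    also have "\<dots> \<le> K * M"
      unfolding K_def
      by (rule powr_diff_le[OF \<open>s > 0\<close> c _ _ low(1) up(1) low(2) up(2) diff])
        (use at t in \<open>auto simp: e_def\<close>)
    finally show ?thesis .
  qed
  ultimately show ?thesis by blast
qed

text \<open>Signed powers are odd, so a negative start reduces to a positive one by negating both
  functions.\<close>

lemma signed_powr_diff_le:
  fixes x y :: "real \<Rightarrow> real"
  assumes "s > 0" "a < b"
    and x: "\<And>t. t \<in> {a..b} \<Longrightarrow> (x has_real_derivative x1 t) (at t within {a..b})"
    and y: "\<And>t. t \<in> {a..b} \<Longrightarrow> (y has_real_derivative y1 t) (at t within {a..b})"
    and eq: "y a = x a" "y1 a = x1 a" and simple: "x a \<noteq> 0 \<or> x1 a \<noteq> 0"
  obtains K e where "K \<ge> 0" "e > 0"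
    "\<And>t M. a \<le> t \<Longrightarrow> t < a + e \<Longrightarrow> t \<le> b \<Longrightarrow> (\<And>z. z \<in> {a..t} \<Longrightarrow> \<bar>y1 z - x1 z\<bar> \<le> M) \<Longrightarrow>
       \<bar>signed_powr s (y t) - signed_powr s (x t)\<bar> \<le> K * M"
proof -
  have "\<exists>K e. K \<ge> 0 \<and> e > 0 \<and> (\<forall>t M. a \<le> t \<and> t < a + e \<and> t \<le> b \<and>
           (\<forall>z\<in>{a..t}. \<bar>y1 z - x1 z\<bar> \<le> M) \<longrightarrow>
           \<bar>signed_powr s (y t) - signed_powr s (x t)\<bar> \<le> K * M)"
  proof (cases "x a > 0 \<or> x a = 0 \<and> x1 a > 0")
    case True
    show ?thesis by (rule signed_powr_diff_le_pos[OF assms(1,2) x y eq True])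
  next
    case False
    then have neg: "- x a > 0 \<or> - x a = 0 \<and> - x1 a > 0" using simple by auto
    have "- y a = - x a" "- y1 a = - x1 a" using eq by auto
    from signed_powr_diff_le_pos[OF assms(1,2) DERIV_minus[OF x] DERIV_minus[OF y] this neg]
    show ?thesis by (simp add: abs_minus_commute)
  qed
  then show ?thesis using that by blast
qed

text \<open>The maximum \<open>M\<close> of the differences of \<open>u1\<close> and
  \<open>w1\<close> controls the differences of the right-hand sides through
  \<open>signed_powr_diff_le\<close>. Integration over a short interval returns
  \<open>M \<le> M / 2\<close>, hence \<open>M = 0\<close>.\<close>

lemma lane_emden_unique_right:
  assumes solu: "lane_emden r s lam a b u u1 w w1" and solv: "lane_emden r s lam a b v v1 z z1"
    and pars: "r > 0" "s > 0" and "a < b"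
    and eq: "v a = u a" "v1 a = u1 a" "z a = w a" "z1 a = w1 a"
    and simple: "u a \<noteq> 0 \<or> u1 a \<noteq> 0" "w a \<noteq> 0 \<or> w1 a \<noteq> 0"
  obtains h where "h > 0" "a + h \<le> b"
    "\<And>t. t \<in> {a..a + h} \<Longrightarrow> v t = u t \<and> v1 t = u1 t \<and> z t = w t \<and> z1 t = w1 t"
proof -
  note U = lane_emdenD[OF solu] and V = lane_emdenD[OF solv]
  obtain K e where K: "K \<ge> 0" "e > 0"
    "\<And>t M. a \<le> t \<Longrightarrow> t < a + e \<Longrightarrow> t \<le> b \<Longrightarrow> (\<And>x. x \<in> {a..t} \<Longrightarrow> \<bar>v1 x - u1 x\<bar> \<le> M) \<Longrightarrow>
       \<bar>signed_powr s (v t) - signed_powr s (u t)\<bar> \<le> K * M"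
    using signed_powr_diff_le[OF \<open>s > 0\<close> \<open>a < b\<close> U(1) V(1) eq(1,2) simple(1)] by blast
  obtain K' e' where K': "K' \<ge> 0" "e' > 0"
    "\<And>t M. a \<le> t \<Longrightarrow> t < a + e' \<Longrightarrow> t \<le> b \<Longrightarrow> (\<And>x. x \<in> {a..t} \<Longrightarrow> \<bar>z1 x - w1 x\<bar> \<le> M) \<Longrightarrow>
       \<bar>signed_powr r (z t) - signed_powr r (w t)\<bar> \<le> K' * M"
    using signed_powr_diff_le[OF \<open>r > 0\<close> \<open>a < b\<close> U(3) V(3) eq(3,4) simple(2)] by blast
  \<comment> \<open>\<open>L\<close> dominates the Lipschitz constants of both right-hand sides; the
    summand 1 makes it positive. The choice of \<open>h\<close> ensures
    \<open>L * h \<le> 1 / 2\<close>.\<close>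
  define L where "L = \<bar>lam\<bar> * K + K' + 1"
  define h where "h = min (b - a) (min (e / 2) (min (e' / 2) (1 / (2 * L))))"
  have L: "L > 0" "K' \<le> L" "\<bar>lam\<bar> * K \<le> L" using K K' by (auto simp: L_def add_nonneg_pos)
  have h: "h > 0" "a + h \<le> b" "h < e" "h < e'" "L * h \<le> 1 / 2"
  proof -
    show "h > 0" "a + h \<le> b" using \<open>a < b\<close> K K' L by (auto simp: h_def)
    show "h < e" "h < e'" using K(2) K'(2) by (auto simp: h_def)
    have "L * h \<le> L * (1 / (2 * L))" using L by (intro mult_left_mono) (auto simp: h_def)
    then show "L * h \<le> 1 / 2" using L by simp
  qed
  have sub: "{a..a + h} \<subseteq> {a..b}" using h by auto
  define N where "N t = max \<bar>v1 t - u1 t\<bar> \<bar>z1 t - w1 t\<bar>" for t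
  have "continuous_on {a..b} N"
    unfolding N_def
    by (intro continuous_intros lane_emden_continuous_on[OF solu] lane_emden_continuous_on[OF solv])
  then have "continuous_on {a..a + h} N"
    using sub by (rule continuous_on_subset)
  then obtain m where m: "m \<in> {a..a + h}" and max: "\<And>t. t \<in> {a..a + h} \<Longrightarrow> N t \<le> N m"
    using continuous_attains_sup[of "{a..a + h}" N] h by auto
  define M where "M = N m"
  have M: "\<bar>v1 t - u1 t\<bar> \<le> M" "\<bar>z1 t - w1 t\<bar> \<le> M" if "t \<in> {a..a + h}" for t
    using max[OF that] by (auto simp: M_def N_def)
  have "M \<ge> 0" using M(1)[of a] h by auto
  \<comment> \<open>Used first for \<open>u1\<close> and \<open>w1\<close>, and again with
    \<open>M = 0\<close> to carry the equality over to \<open>u\<close> and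
    \<open>w\<close>.\<close>
  have bound: "\<bar>f t - g t\<bar> \<le> M / 2"
    if t: "t \<in> {a..a + h}" and "f a = g a"
      and f: "\<And>t. t \<in> {a..b} \<Longrightarrow> (f has_real_derivative f' t) (at t within {a..b})"
      and g: "\<And>t. t \<in> {a..b} \<Longrightarrow> (g has_real_derivative g' t) (at t within {a..b})"
      and le: "\<And>t. t \<in> {a..a + h} \<Longrightarrow> \<bar>f' t - g' t\<bar> \<le> L * M" for f g f' g' t
  proof -
    have "norm ((\<lambda>t. f t - g t) t - (\<lambda>t. f t - g t) a) \<le> L * M * norm (t - a)"
    proof (rule field_differentiable_bound[where S = "{a..a + h}"])
      fix x assume x: "x \<in> {a..a + h}"
      then have x': "x \<in> {a..b}" using sub by blast
      show "((\<lambda>t. f t - g t) has_real_derivative f' x - g' x) (at x within {a..a + h})"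
        by (rule DERIV_diff[OF f[OF x'] g[OF x'], THEN DERIV_subset, OF sub])
      show "norm (f' x - g' x) \<le> L * M" using le[OF x] by simp
    qed (use t h in auto)
    also have "\<dots> \<le> L * M * h"
      using t L \<open>M \<ge> 0\<close> by (intro mult_left_mono) auto
    also have "\<dots> = (L * h) * M" by simp
    also have "\<dots> \<le> 1 / 2 * M"
      using h(5) \<open>M \<ge> 0\<close> by (rule mult_right_mono)
    finally show ?thesis using \<open>f a = g a\<close> by simp
  qed
  have "\<bar>v1 t - u1 t\<bar> \<le> M / 2" if "t \<in> {a..a + h}" for t
  proof (rule bound[OF that eq(2) V(2) U(2)])
    fix x assume x: "x \<in> {a..a + h}"
    have "\<bar>signed_powr r (z x) - signed_powr r (w x)\<bar> \<le> K' * M"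
      using x h by (intro K'(3) M(2)) auto
    also have "\<dots> \<le> L * M" using L(2) \<open>M \<ge> 0\<close> by (rule mult_right_mono)
    finally show "\<bar>signed_powr r (z x) - signed_powr r (w x)\<bar> \<le> L * M" .
  qed
  moreover have "\<bar>z1 t - w1 t\<bar> \<le> M / 2" if "t \<in> {a..a + h}" for t
  proof (rule bound[OF that eq(4) V(4) U(4)])
    fix x assume x: "x \<in> {a..a + h}"
    have "\<bar>lam * signed_powr s (v x) - lam * signed_powr s (u x)\<bar>
          = \<bar>lam\<bar> * \<bar>signed_powr s (v x) - signed_powr s (u x)\<bar>"
      by (simp only: abs_mult flip: right_diff_distrib)
    also have "\<dots> \<le> \<bar>lam\<bar> * (K * M)"
      using x h by (intro mult_left_mono K(3) M(1)) auto
    also have "\<dots> = \<bar>lam\<bar> * K * M" by simp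
    also have "\<dots> \<le> L * M" using L(3) \<open>M \<ge> 0\<close> by (rule mult_right_mono)
    finally show "\<bar>lam * signed_powr s (v x) - lam * signed_powr s (u x)\<bar> \<le> L * M" .
  qed
  ultimately have "N m \<le> M / 2" using m unfolding N_def by (blast intro: max.boundedI)
  then have "M = 0" using \<open>M \<ge> 0\<close> by (simp add: M_def)
  then have d0: "v1 t = u1 t" "z1 t = w1 t" if "t \<in> {a..a + h}" for t
    using M[OF that] by auto
  have "v t = u t \<and> z t = w t" if t: "t \<in> {a..a + h}" for t
    using bound[OF t eq(1) V(1) U(1)] bound[OF t eq(3) V(3) U(3)] d0 \<open>M = 0\<close> by auto
  then show ?thesis
    using that h d0 by blast
qed

text \<open>Continuation: at the infimum \<open>i\<close> of the points of disagreement the states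
  still agree by continuity, and local uniqueness extends the agreement beyond
  \<open>i\<close>.\<close>

lemma lane_emden_unique:
  assumes solu: "lane_emden r s lam a b u u1 w w1" and solv: "lane_emden r s lam a b v v1 z z1"
    and pars: "r > 0" "s > 0"
    and eq: "v a = u a" "v1 a = u1 a" "z a = w a" "z1 a = w1 a"
    and simple: "\<And>t. a \<le> t \<Longrightarrow> t < b \<Longrightarrow> u t \<noteq> 0 \<or> u1 t \<noteq> 0"
      "\<And>t. a \<le> t \<Longrightarrow> t < b \<Longrightarrow> w t \<noteq> 0 \<or> w1 t \<noteq> 0"
    and t: "t \<in> {a..b}"
  shows "v t = u t"
proof -
  define F where "F t = \<bar>v t - u t\<bar> + \<bar>v1 t - u1 t\<bar> + \<bar>z t - w t\<bar> + \<bar>z1 t - w1 t\<bar>" for t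
  have F0: "F t = 0 \<longleftrightarrow> v t = u t \<and> v1 t = u1 t \<and> z t = w t \<and> z1 t = w1 t" for t
    unfolding F_def by linarith
  have "continuous_on {a..b} F"
    unfolding F_def
    by (intro continuous_intros lane_emden_continuous_on[OF solu] lane_emden_continuous_on[OF solv])
  then have "closed ({a..b} \<inter> F -` {0})"
    by (intro continuous_closed_preimage) auto
  have "F t = 0"
  proof (rule ccontr)
    assume "F t \<noteq> 0"
    define S where "S = {x \<in> {a..b}. F x \<noteq> 0}"
    have S: "t \<in> S" "bdd_below S"
      using \<open>F t \<noteq> 0\<close> t by (auto simp: S_def intro!: bdd_belowI[of _ a])
    define i where "i = Inf S"
    have i: "a \<le> i" "i \<le> t"
      unfolding i_def using S by (auto simp: S_def intro: cInf_greatest cInf_lower)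
    have before: "F x = 0" if "a \<le> x" "x < i" for x
    proof (rule ccontr)
      assume "F x \<noteq> 0"
      then have "x \<in> S" using that i t by (simp add: S_def)
      then have "i \<le> x" unfolding i_def using S(2) by (rule cInf_lower)
      then show False using that by simp
    qed
    have "F i = 0"
    proof (cases "i = a")
      case True
      then show ?thesis using F0 eq by simp
    next
      case False
      have "closure {a..<i} \<subseteq> {a..b} \<inter> F -` {0}"
        using before i t \<open>closed _\<close> by (intro closure_minimal) auto
      then show ?thesis using False i by auto
    qed
    then have "i < b"
      using i t \<open>F t \<noteq> 0\<close> by (cases "i = b") auto
    obtain h where h: "h > 0" "i + h \<le> b"
      "\<And>t. t \<in> {i..i + h} \<Longrightarrow> v t = u t \<and> v1 t = u1 t \<and> z t = w t \<and> z1 t = w1 t"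
      using lane_emden_unique_right[OF lane_emden_subinterval[OF solu i(1) order_refl]
          lane_emden_subinterval[OF solv i(1) order_refl] pars \<open>i < b\<close>] \<open>F i = 0\<close>
        simple[OF i(1) \<open>i < b\<close>] F0 by metis
    have "i + h \<le> Inf S"
    proof (rule cInf_greatest)
      fix x assume x: "x \<in> S"
      then have "i \<le> x" unfolding i_def using S by (simp add: cInf_lower)
      then show "i + h \<le> x" using x h(3)[of x] F0[of x] by (fastforce simp: S_def)
    qed (use S in auto)
    then show False using h by (simp add: i_def)
  qed
  then show ?thesis using F0 by simp
qed

section \<open>Odd reflection and the Dirichlet problem\<close>

text \<open>The nonlinearities are odd, so \<open>- u (2 * T - t)\<close> continues the solution
  beyond \<open>T\<close>; \<open>u\<close> and \<open>w\<close> match because they vanish at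
  \<open>T\<close>, their derivatives match automatically. The boundary values recur at
  \<open>2 * T\<close>, so the construction can be repeated with the same bound.\<close>

lemma lane_emden_odd_extension:
  assumes sol: "lane_emden r s lam 0 T u u1 w w1" and "0 < T"
    and bc: "u 0 = 0" "u T = 0" "w 0 = 0" "w T = 0" and M: "\<And>t. t \<in> {0..T} \<Longrightarrow> \<bar>w t\<bar> \<le> M"
  shows "\<exists>v v1 z z1. lane_emden r s lam 0 (2 * T) v v1 z z1 \<and> v 0 = 0 \<and> v (2 * T) = 0 \<and>
     z 0 = 0 \<and> z (2 * T) = 0 \<and> v1 0 = u1 0 \<and> z1 0 = w1 0 \<and> (\<forall>t\<in>{0..2 * T}. \<bar>z t\<bar> \<le> M)"
proof -
  have "lane_emden r s lam T (2 * T) (\<lambda>t. - u (2 * T - t)) (\<lambda>t. u1 (2 * T - t))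
      (\<lambda>t. - w (2 * T - t)) (\<lambda>t. w1 (2 * T - t))"
    using lane_emden_affine[OF sol, where a' = T and b' = "2 * T" and A = "-1" and C = "-1"
        and c = "-1" and d = "2 * T"]
    by simp
  from lane_emden_glue[OF _ _ sol this] bc \<open>0 < T\<close>
  have "lane_emden r s lam 0 (2 * T) (\<lambda>t. if t \<le> T then u t else - u (2 * T - t))
     (\<lambda>t. if t \<le> T then u1 t else u1 (2 * T - t)) (\<lambda>t. if t \<le> T then w t else - w (2 * T - t))
     (\<lambda>t. if t \<le> T then w1 t else w1 (2 * T - t))"
    by simp
  moreover have "\<bar>if t \<le> T then w t else - w (2 * T - t)\<bar> \<le> M" if "t \<in> {0..2 * T}" for t
    using M[of t] M[of "2 * T - t"] that by auto
  ultimately show ?thesis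
    using bc \<open>0 < T\<close> by (intro exI conjI ballI) (assumption | simp)+
qed

lemma lane_emden_bounded_extension:
  assumes sol: "lane_emden r s lam 0 T u u1 w w1" and "0 < T"
    and bc: "u 0 = 0" "u T = 0" "w 0 = 0" "w T = 0"
  obtains M where "\<And>n. \<exists>v v1 z z1. lane_emden r s lam 0 (2 ^ n * T) v v1 z z1 \<and> v 0 = 0 \<and>
     z 0 = 0 \<and> v1 0 = u1 0 \<and> z1 0 = w1 0 \<and> (\<forall>t\<in>{0..2 ^ n * T}. \<bar>z t\<bar> \<le> M)"
proof -
  obtain M where M: "\<And>t. t \<in> {0..T} \<Longrightarrow> \<bar>w t\<bar> \<le> M"
    using bounded_on_interval[OF lane_emden_continuous_on(3)[OF sol]] by blast
  \<comment> \<open>The induction also carries the zero values at the right end, which the next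
    reflection needs.\<close>
  have "\<exists>v v1 z z1. lane_emden r s lam 0 (2 ^ n * T) v v1 z z1 \<and> v 0 = 0 \<and> v (2 ^ n * T) = 0 \<and>
     z 0 = 0 \<and> z (2 ^ n * T) = 0 \<and> v1 0 = u1 0 \<and> z1 0 = w1 0 \<and>
     (\<forall>t\<in>{0..2 ^ n * T}. \<bar>z t\<bar> \<le> M)" for n
  proof (induction n)
    case 0
    show ?case
      using sol bc M by (intro exI[of _ u] exI[of _ u1] exI[of _ w] exI[of _ w1]) auto
  next
    case (Suc n)
    then obtain v v1 z z1 where "lane_emden r s lam 0 (2 ^ n * T) v v1 z z1"
      "v 0 = 0" "v (2 ^ n * T) = 0" "z 0 = 0" "z (2 ^ n * T) = 0" "v1 0 = u1 0" "z1 0 = w1 0"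
      "\<And>t. t \<in> {0..2 ^ n * T} \<Longrightarrow> \<bar>z t\<bar> \<le> M"
      by blast
    from lane_emden_odd_extension[OF this(1) _ this(2-5,8)] this(6,7) \<open>0 < T\<close>
    show ?case by (simp add: mult.assoc)
  qed
  then show ?thesis using that by blast
qed

text \<open>If \<open>z1 0\<close> were larger, the differences of the extended solutions would form
  a cooperative pair with nonnegative data, forcing linear growth of a difference that is bounded by
  \<open>M + M'\<close> on arbitrarily long intervals.\<close>

lemma lane_emden_dirichlet_w1_le:
  assumes solu: "lane_emden r s lam 0 T u u1 w w1" and solv: "lane_emden r s lam 0 T' v v1 z z1"
    and pars: "r > 0" "s > 0" "lam > 0" and "0 < T" "0 < T'"
    and bcu: "u 0 = 0" "u T = 0" "w 0 = 0" "w T = 0"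
    and bcv: "v 0 = 0" "v T' = 0" "z 0 = 0" "z T' = 0"
    and slope: "v1 0 = u1 0"
  shows "z1 0 \<le> w1 0"
proof (rule ccontr)
  define d where "d = z1 0 - w1 0"
  assume "\<not> z1 0 \<le> w1 0"
  then have d: "d > 0" by (simp add: d_def)
  obtain M where M: "\<And>n. \<exists>v v1 z z1. lane_emden r s lam 0 (2 ^ n * T) v v1 z z1 \<and> v 0 = 0 \<and>
     z 0 = 0 \<and> v1 0 = u1 0 \<and> z1 0 = w1 0 \<and> (\<forall>t\<in>{0..2 ^ n * T}. \<bar>z t\<bar> \<le> M)"
    using lane_emden_bounded_extension[OF solu \<open>0 < T\<close> bcu] by blast
  obtain M' where M': "\<And>n. \<exists>u u1 w w1. lane_emden r s lam 0 (2 ^ n * T') u u1 w w1 \<and> u 0 = 0 \<and>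
     w 0 = 0 \<and> u1 0 = v1 0 \<and> w1 0 = z1 0 \<and> (\<forall>t\<in>{0..2 ^ n * T'}. \<bar>w t\<bar> \<le> M')"
    using lane_emden_bounded_extension[OF solv \<open>0 < T'\<close> bcv] by blast
  define T0 where "T0 = min T T'"
  have "T0 > 0" using \<open>0 < T\<close> \<open>0 < T'\<close> by (simp add: T0_def)
  \<comment> \<open>So many doublings that linear growth with slope \<open>d\<close> exceeds
    \<open>M + M'\<close> on an interval inside both extended domains.\<close>
  obtain n where "(M + M') / (d * T0) < 2 ^ n"
    using real_arch_pow[of 2] by auto
  then have n: "M + M' < d * (2 ^ n * T0)"
    using d \<open>T0 > 0\<close> by (simp add: pos_divide_less_eq mult_ac)
  define L where "L = 2 ^ n * T0"
  have L: "L > 0" "L \<le> 2 ^ n * T" "L \<le> 2 ^ n * T'"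
    using \<open>T0 > 0\<close> by (auto simp: L_def T0_def)
  obtain U U1 W W1 where U: "lane_emden r s lam 0 (2 ^ n * T) U U1 W W1" "U 0 = 0"
     "W 0 = 0" "U1 0 = u1 0" "W1 0 = w1 0" "\<forall>t\<in>{0..2 ^ n * T}. \<bar>W t\<bar> \<le> M"
    using M[of n] by blast
  obtain V V1 Z Z1 where V: "lane_emden r s lam 0 (2 ^ n * T') V V1 Z Z1" "V 0 = 0"
     "Z 0 = 0" "V1 0 = v1 0" "Z1 0 = z1 0" "\<forall>t\<in>{0..2 ^ n * T'}. \<bar>Z t\<bar> \<le> M'"
    using M'[of n] by blast
  note DU = lane_emdenD[OF lane_emden_subinterval[OF U(1) order_refl L(2)]]
  note DV = lane_emdenD[OF lane_emden_subinterval[OF V(1) order_refl L(3)]]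
  have d1: "((\<lambda>t. V t - U t) has_real_derivative V1 t - U1 t) (at t within {0..L})"
    and d2: "((\<lambda>t. V1 t - U1 t) has_real_derivative signed_powr r (Z t) - signed_powr r (W t)) (at t within {0..L})"
    and d3: "((\<lambda>t. Z t - W t) has_real_derivative Z1 t - W1 t) (at t within {0..L})"
    and d4: "((\<lambda>t. Z1 t - W1 t) has_real_derivative lam * signed_powr s (V t) - lam * signed_powr s (U t)) (at t within {0..L})"
    if "t \<in> {0..L}" for t
    by (intro DERIV_diff DU DV that)+
  obtain e where e: "e > 0" "\<And>t. 0 < t \<Longrightarrow> t < 0 + e \<Longrightarrow> t \<le> L \<Longrightarrow> Z t - W t > 0"
    using pos_right_of[OF d3 L(1)] d U V by (auto simp: d_def)
  \<comment> \<open>The roles are \<open>D = Z - W\<close>, which starts with slope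
    \<open>d > 0\<close>, and \<open>E = V - U\<close>, which starts with slope 0. Cooperativity is
    the strict monotonicity of signed powers.\<close>
  have "Z L - W L > (Z 0 - W 0) + (Z1 0 - W1 0) * (L - 0)"
  proof (rule cooperative_above_tangents(1)[OF L(1) d3 d4 d1 d2 _ _ _ _ _ _ e])
    show "lam * signed_powr s (V t) - lam * signed_powr s (U t) > 0" if "V t - U t > 0" for t
      using that pars by (simp add: signed_powr_less_iff)
    show "signed_powr r (Z t) - signed_powr r (W t) > 0" if "Z t - W t > 0" for t
      using that pars by (simp add: signed_powr_less_iff)
  qed (use U V d slope L in \<open>auto simp: d_def\<close>)
  then have "d * L < Z L - W L"
    using U V by (simp add: d_def)
  moreover have "\<bar>Z L\<bar> \<le> M'" "\<bar>W L\<bar> \<le> M"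
    using U(6) V(6) L by auto
  ultimately show False using n by (simp add: L_def)
qed

lemma lane_emden_dirichlet_unique_le:
  assumes solu: "lane_emden r s lam 0 T u u1 w w1" and solv: "lane_emden r s lam 0 T' v v1 z z1"
    and pars: "r > 0" "s > 0" "lam > 0" and "0 < T" "T \<le> T'"
    and bcu: "u 0 = 0" "u T = 0" "w 0 = 0" "w T = 0"
    and bcv: "v 0 = 0" "v T' = 0" "z 0 = 0" "z T' = 0"
    and slope: "v1 0 = u1 0"
    and zeros: "has_n_zeros n {0<..<T} u" "has_n_zeros n {0<..<T'} v"
  shows "T = T' \<and> (\<forall>t\<in>{0..T}. v t = u t)"
proof -
  have "0 < T'" using \<open>0 < T\<close> \<open>T \<le> T'\<close> by simp
  have "z1 0 = w1 0"
    using lane_emden_dirichlet_w1_le[OF solu solv pars \<open>0 < T\<close> \<open>0 < T'\<close> bcu bcv slope]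
      lane_emden_dirichlet_w1_le[OF solv solu pars \<open>0 < T'\<close> \<open>0 < T\<close> bcv bcu slope[symmetric]]
    by simp
  have "{t \<in> {0..T}. u t = 0} \<subseteq> {t \<in> {0<..<T}. u t = 0} \<union> {0, T}" by auto
  then have fin: "finite {t \<in> {0..T}. u t = 0}"
    using zeros(1) unfolding has_n_zeros_def by (meson finite.intros finite_UnI finite_subset)
  have eq: "v t = u t" if "t \<in> {0..T}" for t
    by (rule lane_emden_unique[OF solu lane_emden_subinterval[OF solv order_refl \<open>T \<le> T'\<close>] pars(1,2)
          _ slope _ \<open>z1 0 = w1 0\<close> lane_emden_simple_zeros[OF solu pars fin bcu(1-3)] that])
      (simp_all add: bcu bcv)
  have "T = T'"
  proof (rule ccontr)
    assume "T \<noteq> T'"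
    \<comment> \<open>If \<open>T < T'\<close>, then \<open>v\<close> inherits the \<open>n\<close>
      interior zeros of \<open>u\<close> and has a further one at \<open>T\<close>, which is
      interior to the longer interval.\<close>
    then have "insert T {t \<in> {0<..<T}. u t = 0} \<subseteq> {t \<in> {0<..<T'}. v t = 0}"
      using eq \<open>T \<le> T'\<close> \<open>0 < T\<close> bcu by auto
    then have "card (insert T {t \<in> {0<..<T}. u t = 0}) \<le> n"
      using zeros(2) unfolding has_n_zeros_def by (metis card_mono)
    then show False
      using zeros(1) by (simp add: has_n_zeros_def)
  qed
  then show ?thesis using eq by blast
qed

lemma lane_emden_dirichlet_unique:
  assumes solu: "lane_emden r s lam 0 T u u1 w w1" and solv: "lane_emden r s lam 0 T' v v1 z z1"
    and pars: "r > 0" "s > 0" "lam > 0" and "0 < T" "0 < T'"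
    and bcu: "u 0 = 0" "u T = 0" "w 0 = 0" "w T = 0"
    and bcv: "v 0 = 0" "v T' = 0" "z 0 = 0" "z T' = 0"
    and slope: "v1 0 = u1 0"
    and zeros: "has_n_zeros n {0<..<T} u" "has_n_zeros n {0<..<T'} v"
  shows "T = T'" "\<And>t. t \<in> {0..T} \<Longrightarrow> v t = u t"
proof -
  have "T = T' \<and> (\<forall>t\<in>{0..T}. v t = u t)"
  proof (cases "T \<le> T'")
    case True
    show ?thesis
      by (rule lane_emden_dirichlet_unique_le[OF solu solv pars \<open>0 < T\<close> True bcu bcv slope zeros])
  next
    case False
    then have "T' \<le> T" by simp
    from lane_emden_dirichlet_unique_le[OF solv solu pars \<open>0 < T'\<close> this bcv bcu slope[symmetric]
        zeros(2,1)]
    show ?thesis by auto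
  qed
  then show "T = T'" "\<And>t. t \<in> {0..T} \<Longrightarrow> v t = u t" by auto
qed

section \<open>From eigenfunctions to the system\<close>

lemma C1_on_has_real_derivative:
  assumes "C1_on S f" "t \<in> S"
  shows "(f has_real_derivative deriv_on S f t) (at t within S)"
  using assms unfolding C1_on_def deriv_on_def differentiable_on_def
  by (simp add: has_real_derivative_iff_has_vector_derivative vector_derivative_works)

lemma eigenfunction_lane_emden:
  assumes "1 < p" and eig: "eigenfunction p q t0 lam u"
  obtains u1 w w1 where "lane_emden (1 / (p - 1)) (q - 1) lam 0 t0 u u1 w w1"
    "u 0 = 0" "u t0 = 0" "w 0 = 0" "w t0 = 0"
proof -
  define u1 where "u1 = deriv_on {0..t0} u"
  define w where "w = (\<lambda>t. signed_powr (p - 1) (deriv_on {0..t0} u1 t))"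
  define w1 where "w1 = deriv_on {0..t0} w"
  have reg: "C1_on {0..t0} u" "C1_on {0..t0} u1" "C1_on {0..t0} w" "C1_on {0..t0} w1"
    and eq: "\<And>t. t \<in> {0..t0} \<Longrightarrow> deriv_on {0..t0} w1 t = lam * signed_powr (q - 1) (u t)"
    and bc: "u 0 = 0" "u t0 = 0" "w 0 = 0" "w t0 = 0"
    using eig unfolding eigenfunction_def Let_def u1_def w_def w1_def by auto
  \<comment> \<open>Inverting the signed power recovers \<open>u''\<close> from \<open>w\<close>;
    hence the exponent \<open>1 / (p - 1)\<close>.\<close>
  have "signed_powr (1 / (p - 1)) (w t) = deriv_on {0..t0} u1 t" for t
    unfolding w_def using \<open>1 < p\<close> by (intro signed_powr_inverse) simp
  then have "lane_emden (1 / (p - 1)) (q - 1) lam 0 t0 u u1 w w1"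
    using reg[THEN C1_on_has_real_derivative] eq
    by (simp add: lane_emden_def flip: u1_def w1_def)
  then show ?thesis using that bc by blast
qed

section \<open>Scaling and the conclusion\<close>

lemma has_n_zeros_scale:
  assumes "has_n_zeros n {0<..<T} u" "B > 0" "A \<noteq> 0"
  shows "has_n_zeros n {0<..<T / B} (\<lambda>t. A * u (B * t))"
proof -
  have "{t \<in> {0<..<T / B}. A * u (B * t) = 0} = (\<lambda>t. t / B) ` {t \<in> {0<..<T}. u t = 0}"
  proof (intro subset_antisym subsetI)
    fix t assume "t \<in> {t \<in> {0<..<T / B}. A * u (B * t) = 0}"
    then show "t \<in> (\<lambda>t. t / B) ` {t \<in> {0<..<T}. u t = 0}"
      using assms by (intro image_eqI[of _ _ "B * t"]) (auto simp: field_simps)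
  qed (use assms in \<open>auto simp: divide_strict_right_mono\<close>)
  moreover have "inj_on (\<lambda>t. t / B) X" for X
    using \<open>B > 0\<close> by (auto simp: inj_on_def)
  ultimately show ?thesis
    using assms(1) by (simp add: has_n_zeros_def card_image)
qed

text \<open>With time factor \<open>B\<close> and amplitude \<open>\<sigma> * a\<close>, the
  equation for \<open>u''\<close> forces the factor \<open>C\<close> of \<open>w\<close>, and the
  equation for \<open>w''\<close> then amounts to the relation between \<open>lam\<close> and
  \<open>lam'\<close>.\<close>

lemma lane_emden_scale:
  assumes sol: "lane_emden (1 / (p - 1)) (q - 1) lam 0 T u u1 w w1" and "1 < p"
    and "a > 0" "B > 0" and \<sigma>: "\<bar>\<sigma>\<bar> = 1"
    and lam': "lam * a powr p * B powr (2 * p) = lam' * a powr q"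
  defines "C \<equiv> \<sigma> * (a * B\<^sup>2) powr (p - 1)"
  shows "lane_emden (1 / (p - 1)) (q - 1) lam' 0 (T / B) (\<lambda>t. \<sigma> * a * u (B * t))
     (\<lambda>t. \<sigma> * a * B * u1 (B * t)) (\<lambda>t. C * w (B * t)) (\<lambda>t. C * B * w1 (B * t))"
proof -
  have sgn: "signed_powr e (\<sigma> * x) = \<sigma> * x powr e" if "x > 0" for e x
    using \<sigma> that by (cases "\<sigma> > 0") (auto simp: signed_powr_def sgn_mult abs_mult sgn_if)
  have aB: "a * B\<^sup>2 > 0" using assms by simp
  have "a * B\<^sup>2 = a powr 1 * B powr 2" using assms by simp
  then have "a * (B\<^sup>2 * (a * B\<^sup>2) powr (p - 1)) = (a powr 1 * a powr (p - 1)) * (B powr 2 * (B powr 2) powr (p - 1))"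
    using assms by (simp add: powr_mult mult_ac)
  also have "a powr 1 * a powr (p - 1) = a powr p"
    using powr_add[of a 1 "p - 1"] by simp
  also have "B powr 2 * (B powr 2) powr (p - 1) = B powr (2 + 2 * (p - 1))"
    by (simp only: powr_powr powr_add)
  finally have "a * (B\<^sup>2 * (a * B\<^sup>2) powr (p - 1)) * lam = lam' * a powr q"
    using lam' by (simp add: mult_ac)
  also have "a powr q = a * a powr (q - 1)"
    using powr_add[of a 1 "q - 1"] \<open>a > 0\<close> by simp
  finally have *: "(a * B\<^sup>2) powr (p - 1) * B\<^sup>2 * lam = lam' * a powr (q - 1)"
    using \<open>a > 0\<close> by (simp add: mult_ac)
  have "signed_powr (1 / (p - 1)) C = \<sigma> * a * B\<^sup>2"
  proof -
    have "(a * B\<^sup>2) powr (p - 1) > 0" using aB by (simp only: powr_gt_zero)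
    from sgn[OF this] show ?thesis
      unfolding C_def using aB \<open>1 < p\<close> by (simp add: powr_powr mult.assoc)
  qed
  moreover have "C * B\<^sup>2 * lam = lam' * signed_powr (q - 1) (\<sigma> * a)"
    unfolding C_def using * sgn[OF \<open>a > 0\<close>, of "q - 1"] by (simp add: mult_ac)
  moreover have "B * t + 0 \<in> {0..T}" if "t \<in> {0..T / B}" for t
    using that \<open>B > 0\<close> by (auto simp: field_simps)
  ultimately show ?thesis
    using lane_emden_affine[OF sol, of 0 "T / B" B 0 "\<sigma> * a" C lam']
    by (simp add: signed_powr_mult[of _ C] signed_powr_mult[of _ "\<sigma> * a"])
qed

theorem corollary5p1:
  fixes p q t0 lam lam' :: real and n :: nat and u u' :: "real \<Rightarrow> real"
  assumes "1 < p" and "1 < q" and "0 < t0"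
    and "0 < lam" and "0 < lam'"
    and "eigenfunction p q t0 lam u" and "eigenfunction p q t0 lam' u'"
    and "has_n_zeros n {0<..<t0} u" and "has_n_zeros n {0<..<t0} u'"
  shows "\<exists>a>0. ((\<forall>t\<in>{0..t0}. u' t = a * u t) \<or> (\<forall>t\<in>{0..t0}. u' t = - a * u t))
               \<and> lam' = lam * a powr (p - q)"
proof -
  obtain u1 w w1 where u: "lane_emden (1 / (p - 1)) (q - 1) lam 0 t0 u u1 w w1"
    and bcu: "u 0 = 0" "u t0 = 0" "w 0 = 0" "w t0 = 0"
    using eigenfunction_lane_emden[OF \<open>1 < p\<close> assms(6)] by blast
  obtain v1 z z1 where v: "lane_emden (1 / (p - 1)) (q - 1) lam' 0 t0 u' v1 z z1"
    and bcv: "u' 0 = 0" "u' t0 = 0" "z 0 = 0" "z t0 = 0"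
    using eigenfunction_lane_emden[OF \<open>1 < p\<close> assms(7)] by blast
  have pars: "1 / (p - 1) > 0" "q - 1 > 0" using assms by auto
  have fin: "finite {t \<in> {0..t0}. f t = 0}" if "has_n_zeros n {0<..<t0} f" for f :: "real \<Rightarrow> real"
  proof (rule finite_subset)
    show "{t \<in> {0..t0}. f t = 0} \<subseteq> {t \<in> {0<..<t0}. f t = 0} \<union> {0, t0}" by auto
  qed (use that in \<open>simp add: has_n_zeros_def\<close>)
  have u1: "u1 0 \<noteq> 0"
    using lane_emden_simple_zeros(1)[OF u pars \<open>0 < lam\<close> fin[OF assms(8)] bcu(1-3), of 0] bcu \<open>0 < t0\<close>
    by simp
  have v1: "v1 0 \<noteq> 0"
    using lane_emden_simple_zeros(1)[OF v pars \<open>0 < lam'\<close> fin[OF assms(9)] bcv(1-3), of 0] bcv \<open>0 < t0\<close>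
    by simp
  \<comment> \<open>Two conditions determine \<open>a\<close> and \<open>B\<close>: equal initial
    slopes up to sign require \<open>a * B = \<kappa>\<close>, and the equation with
    \<open>lam'\<close> requires \<open>lam * a powr p * B powr (2 * p) = lam' * a powr q\<close>.
    Eliminating \<open>B\<close> gives
    \<open>a powr (p + q) = lam * \<kappa> powr (2 * p) / lam'\<close>.\<close>
  define \<kappa> where "\<kappa> = \<bar>v1 0 / u1 0\<bar>"
  define \<sigma> where "\<sigma> = sgn (v1 0 / u1 0)"
  define a where "a = (lam * \<kappa> powr (2 * p) / lam') powr (1 / (p + q))"
  define B where "B = \<kappa> / a"
  have "\<kappa> > 0" "\<bar>\<sigma>\<bar> = 1" using u1 v1 by (auto simp: \<kappa>_def \<sigma>_def abs_sgn_eq abs_mult)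
  have "a > 0" using \<open>\<kappa> > 0\<close> assms by (simp add: a_def)
  then have "B > 0" using \<open>\<kappa> > 0\<close> by (simp add: B_def)
  have slope: "v1 0 = \<sigma> * a * B * u1 (B * 0)"
  proof -
    have "\<sigma> * a * B * u1 (B * 0) = \<sigma> * \<kappa> * u1 0" using \<open>a > 0\<close> by (simp add: B_def)
    also have "\<sigma> * \<kappa> = v1 0 / u1 0" unfolding \<kappa>_def \<sigma>_def by (rule sgn_mult_abs)
    finally show ?thesis using u1 by simp
  qed
  have lam': "lam * a powr p * B powr (2 * p) = lam' * a powr q"
  proof -
    have "a powr (p + q) = lam * \<kappa> powr (2 * p) / lam'"
      using assms \<open>\<kappa> > 0\<close> by (simp add: a_def powr_powr)
    then have "lam * \<kappa> powr (2 * p) = lam' * (a powr p * a powr q)"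
      using \<open>0 < lam'\<close> by (simp add: field_simps powr_add)
    moreover have "B powr (2 * p) = \<kappa> powr (2 * p) / (a powr p * a powr p)"
      using \<open>a > 0\<close> \<open>\<kappa> > 0\<close> by (simp add: B_def powr_divide flip: powr_add)
    ultimately have "lam * a powr p * B powr (2 * p) * a powr p = lam' * a powr q * a powr p"
      using \<open>a > 0\<close> by (simp add: mult_ac)
    then show ?thesis using \<open>a > 0\<close> by simp
  qed
  define C where "C = \<sigma> * (a * B\<^sup>2) powr (p - 1)"
  note sol = lane_emden_scale[OF u \<open>1 < p\<close> \<open>a > 0\<close> \<open>B > 0\<close> \<open>\<bar>\<sigma>\<bar> = 1\<close> lam', folded C_def]
  have zeros: "has_n_zeros n {0<..<t0 / B} (\<lambda>t. \<sigma> * a * u (B * t))"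
    using has_n_zeros_scale[OF assms(8) \<open>B > 0\<close>, of "\<sigma> * a"] \<open>a > 0\<close> \<open>\<bar>\<sigma>\<bar> = 1\<close> by auto
  have "0 < t0 / B" using \<open>0 < t0\<close> \<open>B > 0\<close> by simp
  note uniq = lane_emden_dirichlet_unique[OF sol v pars \<open>0 < lam'\<close> \<open>0 < t0 / B\<close> \<open>0 < t0\<close> _ _ _ _ bcv
      slope zeros assms(9)]
  \<comment> \<open>The rescaled \<open>u\<close> lives on an interval of length
    \<open>t0 / B\<close> and has the same initial slope as \<open>u'\<close>, so the lengths agree
    and \<open>B = 1\<close>. The relation between the eigenvalues then reduces to
    \<open>lam * a powr p = lam' * a powr q\<close>.\<close>
  have "t0 / B = t0"
    using \<open>B > 0\<close> bcu by (intro uniq(1)) auto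
  then have "B = 1" using \<open>0 < t0\<close> \<open>B > 0\<close> by (simp add: field_simps)
  have eq: "u' t = \<sigma> * a * u t" if "t \<in> {0..t0}" for t
    using uniq(2)[of t] that bcu \<open>B = 1\<close> by simp
  have "lam' = lam * a powr (p - q)"
    using lam' \<open>B = 1\<close> \<open>a > 0\<close> by (simp add: powr_diff field_simps)
  moreover have "\<sigma> = 1 \<or> \<sigma> = - 1" using \<open>\<bar>\<sigma>\<bar> = 1\<close> by linarith
  ultimately show ?thesis
    using eq \<open>a > 0\<close> by (intro exI[of _ a]) auto
qed

end
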